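(* Let $\mathcal{X}$ be an arbitrary domain, $\mathcal{H}\subseteq\{0,1\}^{\mathcal{X}}$ a concept class, and $m\in\mathbb{N}$. Let $\omega^\star_m$ and $\chi^\star_m$ denote the fractional clique and fractional chromatic numbers of $G_m(\mathcal{H})$. Then $\omega^\star_m=\chi^\star_m\le 2^m$. Moreover, the supremum over $\mu$ in the definition of $\chi^\star_m$ is attained, i.e. there is $\mu\in\Delta(\{0,1\}^{\mathcal{X}})$ with $\inf_{\nu\in\Delta(V_m^{\mathcal{H}})}\mathbb{E}_{h\sim\mu,S\sim\nu}[\mathbb{1}[h\text{ consistent with }S]]=1/\chi^\star_m$.
   Context: A dataset of size $m$ is $S=((x_1,y_1),\dots,(x_m,y_m))\in(\mathcal{X}\times\{0,1\})^m$; $h\in\{0,1\}^{\mathcal{X}}$ is consistent with $S$ if $h(x_i)=y_i$ for all $i$; $S$ is $\mathcal{H}$-realizable if some $h\in\mathcal{H}$ is consistent with it; $V_m(\mathcal{H})$ is the set of realizable datasets of size $m$; $G_m(\mathcal{H})$ is the graph on $V_m(\mathcal{H})$ with $S,S'$ adjacent iff there is $x$ with $(x,0)$ appearing in $S$ and $(x,1)$ appearing in $S'$. Equip $\{0,1\}^{\mathcal{X}}$ with the product topology (of discrete $\{0,1\}$) and let $\Delta(\{0,1\}^{\mathcal{X}})$ be the set of regular Borel probability measures on it; let $\Delta(V_m^{\mathcal{H}})$ be the set of finitely supported probability distributions on $V_m(\mathcal{H})$. Define $\frac{1}{\chi^\star_m}=\sup_{\mu\in\Delta(\{0,1\}^{\mathcal{X}})}\inf_{\nu\in\Delta(V_m^{\mathcal{H}})}\mathbb{E}_{h\sim\mu,S\sim\nu}[\mathbb{1}[h\text{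 consistent with }S]]$ and $\frac{1}{\omega^\star_m}=\inf_{\nu\in\Delta(V_m^{\mathcal{H}})}\sup_{\mu\in\Delta(\{0,1\}^{\mathcal{X}})}\mathbb{E}_{h\sim\mu,S\sim\nu}[\mathbb{1}[h\text{ consistent with }S]]$, with conventions $1/0=\infty$, $1/\infty=0$. (This $\omega^\star_m$ coincides with the supremum of $\sum_v\delta(v)$ over fractional cliques $\delta:V_m(\mathcal{H})\to[0,\infty)$, i.e. functions with $\sum_{v\in I}\delta(v)\le1$ for every independent set $I$.) *)

theory Defs
  imports "HOL-Probability.Probability"
begin

text \<open>Hypotheses are functions 'x => bool (bool plays the role of {0,1}); the type
  'x => bool carries the product topology of the discrete (order) topology on bool
  (library instance), and borel is its Borel sigma-algebra. Datasets are lists of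
  labelled examples.\<close>

definition consistent :: "('x \<Rightarrow> bool) \<Rightarrow> ('x \<times> bool) list \<Rightarrow> bool" where
  "consistent h S \<longleftrightarrow> (\<forall>(x, y) \<in> set S. h x = y)"

definition realizable :: "('x \<Rightarrow> bool) set \<Rightarrow> ('x \<times> bool) list \<Rightarrow> bool" where
  "realizable H S \<longleftrightarrow> (\<exists>h\<in>H. consistent h S)"

definition realizable_datasets :: "('x \<Rightarrow> bool) set \<Rightarrow> nat \<Rightarrow> ('x \<times> bool) list set" where
  "realizable_datasets H m = {S. length S = m \<and> realizable H S}"

definition Gm_adj :: "('x \<Rightarrow> bool) set \<Rightarrow> nat \<Rightarrow> ('x \<times> bool) list \<Rightarrow> ('x \<times> bool) list \<Rightarrow> bool" where
  "Gm_adj H m S S' \<longleftrightarrow> S \<in> realizable_datasets H m \<and> S' \<in> realizable_datasets H m \<and>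
     (\<exists>x. (x, False) \<in> set S \<and> (x, True) \<in> set S')"

definition regular_measure :: "'a::topological_space measure \<Rightarrow> bool" where
  "regular_measure M \<longleftrightarrow> (\<forall>B\<in>sets M.
      emeasure M B = (INF U\<in>{U. open U \<and> B \<subseteq> U}. emeasure M U) \<and>
      emeasure M B = (SUP K\<in>{K. compact K \<and> K \<subseteq> B}. emeasure M K))"

definition hyp_dists :: "('x \<Rightarrow> bool) measure set" where
  "hyp_dists = {\<mu>. prob_space \<mu> \<and> sets \<mu> = sets borel \<and> regular_measure \<mu>}"

definition data_dists :: "('x \<Rightarrow> bool) set \<Rightarrow> nat \<Rightarrow> ('x \<times> bool) list pmf set" where
  "data_dists H m = {\<nu>. finite (set_pmf \<nu>) \<and> set_pmf \<nu> \<subseteq> realizable_datasets H m}"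

text \<open>E_{h~mu, S~nu}[1[h consistent with S]], computed as the iterated expectation
  E_{S~nu} E_{h~mu} 1[h consistent with S] (nu is finitely supported, and for each S the
  set of consistent h is a clopen cylinder, hence Borel).\<close>
definition game_value :: "('x \<Rightarrow> bool) measure \<Rightarrow> ('x \<times> bool) list pmf \<Rightarrow> real" where
  "game_value \<mu> \<nu> = (\<integral>S. (\<integral>h. of_bool (consistent h S) \<partial>\<mu>) \<partial>measure_pmf \<nu>)"

text \<open>1/chi*_m = sup_mu inf_nu E  and  1/omega*_m = inf_nu sup_mu E  (in extended reals,
  so that an empty infimum is +infinity).\<close>
definition inv_chi_star :: "('x \<Rightarrow> bool) set \<Rightarrow> nat \<Rightarrow> ereal" where
  "inv_chi_star H m = (SUP \<mu>\<in>hyp_dists. INF \<nu>\<in>data_dists H m. ereal (game_value \<mu> \<nu>))"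

definition inv_omega_star :: "('x \<Rightarrow> bool) set \<Rightarrow> nat \<Rightarrow> ereal" where
  "inv_omega_star H m = (INF \<nu>\<in>data_dists H m. SUP \<mu>\<in>hyp_dists. ereal (game_value \<mu> \<nu>))"

definition ereal_recip :: "ereal \<Rightarrow> ereal" where
  "ereal_recip t = (if t = 0 then \<infinity> else if t = \<infinity> then 0 else ereal (1 / real_of_ereal t))"

definition chi_star :: "('x \<Rightarrow> bool) set \<Rightarrow> nat \<Rightarrow> ereal" where
  "chi_star H m = ereal_recip (inv_chi_star H m)"

definition omega_star :: "('x \<Rightarrow> bool) set \<Rightarrow> nat \<Rightarrow> ereal" where
  "omega_star H m = ereal_recip (inv_omega_star H m)"

end

theory Submission
  imports Defs
begin

text \<open>
  Let \<open>v = 1/\<omega>\<^sup>\<star>\<close>. For every distribution on finitely many datasets some hypothesis has payoff at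
  least \<open>v\<close>, so Blackwell's approachability argument yields, for any finite set of datasets and any
  \<open>\<epsilon> > 0\<close>, an empirical distribution of hypotheses that is consistent with each of these datasets
  with probability at least \<open>v - \<epsilon>\<close>. Finitely additive probabilities on all subsets of the
  hypothesis space form a compact subset of a product of unit intervals, so one of them gives
  probability at least \<open>v\<close> to the hypotheses consistent with any realizable dataset.
  Approximating open sets from inside by closed sets and arbitrary sets from outside by open sets
  turns it into an outer measure, and Caratheodory's theorem gives a regular Borel measure that
  does not decrease the mass of clopen sets; the hypotheses consistent with a dataset are such
  a set. Together with weak duality this is strong duality with attainment. The bound
  \<open>2\<^sup>m\<close> comes from labelling the relevant points by independent fair coins.
\<close>

section \<open>Regular Borel extensions of finitely additive probabilities\<close>

locale finitely_additive_prob =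
  fixes c :: "'a::topological_space set \<Rightarrow> real"
  assumes compact_UNIV: "compact (UNIV :: 'a set)"
    and normal_UNIV: "normal_space (euclidean :: 'a topology)"
    and nonneg: "c A \<ge> 0"
    and additive: "A \<inter> B = {} \<Longrightarrow> c (A \<union> B) = c A + c B"
    and total: "c UNIV = 1"
begin

lemma content_empty: "c {} = 0"
  using additive[of "{}" "{}"] by simp

lemma content_mono: "A \<subseteq> B \<Longrightarrow> c A \<le> c B"
  using additive[of A "B - A"] nonneg[of "B - A"] by (simp add: Un_absorb1)

lemma content_subadditive: "c (A \<union> B) \<le> c A + c B"
  using additive[of A "B - A"] content_mono[of "B - A" B] by simp

section \<open>Inner and outer contents and their countable subadditivity\<close>

text \<open>Meant for open \<open>U\<close>. Even there it can be smaller than \<open>c U\<close>: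
  only the mass carried by closed subsets is kept.\<close>

definition inner_content :: "'a set \<Rightarrow> ennreal" where
  "inner_content U = (SUP K\<in>{K. closed K \<and> K \<subseteq> U}. ennreal (c K))"

definition outer_content :: "'a set \<Rightarrow> ennreal" where
  "outer_content A = (INF U\<in>{U. open U \<and> A \<subseteq> U}. inner_content U)"

lemma inner_upper: "closed K \<Longrightarrow> K \<subseteq> U \<Longrightarrow> ennreal (c K) \<le> inner_content U"
  unfolding inner_content_def by (rule SUP_upper) simp

lemma inner_least: "(\<And>K. closed K \<Longrightarrow> K \<subseteq> U \<Longrightarrow> ennreal (c K) \<le> b) \<Longrightarrow> inner_content U \<le> b"
  unfolding inner_content_def by (rule SUP_least) simp

lemma inner_mono: "U \<subseteq> V \<Longrightarrow> inner_content U \<le> inner_content V"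
  by (intro inner_least inner_upper) auto

lemma outer_lower: "open U \<Longrightarrow> A \<subseteq> U \<Longrightarrow> outer_content A \<le> inner_content U"
  unfolding outer_content_def by (rule INF_lower) simp

lemma outer_greatest: "(\<And>U. open U \<Longrightarrow> A \<subseteq> U \<Longrightarrow> b \<le> inner_content U) \<Longrightarrow> b \<le> outer_content A"
  unfolding outer_content_def by (rule INF_greatest) simp

lemma outer_open: "open U \<Longrightarrow> outer_content U = inner_content U"
  by (intro antisym outer_lower outer_greatest inner_mono) auto

lemma outer_mono: "A \<subseteq> B \<Longrightarrow> outer_content A \<le> outer_content B"
  by (intro outer_greatest outer_lower) auto

lemma inner_empty: "inner_content {} = 0"
  using inner_least[of "{}" 0] by (simp add: content_empty)

lemma inner_UNIV: "inner_content UNIV = 1"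
proof (rule antisym)
  show "inner_content UNIV \<le> 1"
    using content_mono[of _ UNIV] total by (intro inner_least) simp
  show "1 \<le> inner_content UNIV"
    using inner_upper[of UNIV UNIV] total by simp
qed

lemma outer_finite: "outer_content A < \<top>"
proof -
  have "outer_content A \<le> 1"
    using outer_mono[of A UNIV] inner_UNIV outer_open[of UNIV] by simp
  then show ?thesis
    using ennreal_one_less_top by (rule le_less_trans)
qed

text \<open>Normality separates the disjoint closed sets \<open>K - U\<close> and
  \<open>K - V\<close> by disjoint open \<open>U'\<close> and \<open>V'\<close>. Then
  \<open>K - U'\<close> and \<open>K - V'\<close> are closed subsets of \<open>U\<close> and
  \<open>V\<close> that together cover \<open>K\<close>.\<close>

lemma inner_Un:
  assumes "open U" "open V"
  shows "inner_content (U \<union> V) \<le> inner_content U + inner_content V"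
proof (rule inner_least)
  fix K assume K: "closed K" "K \<subseteq> U \<union> V"
  have "closed (K - U)" "closed (K - V)" "disjnt (K - U) (K - V)"
    using K assms by (auto simp: disjnt_def)
  then obtain U' V' where U'V': "open U'" "open V'" "K - U \<subseteq> U'" "K - V \<subseteq> V'" "disjnt U' V'"
    using normal_UNIV unfolding normal_space_def by (metis closed_closedin open_openin)
  have "c K \<le> c (K - U') + c (K - V')"
    using content_mono[of K "(K - U') \<union> (K - V')"] content_subadditive[of "K - U'" "K - V'"] U'V'
    by (force simp: disjnt_iff)
  then have "ennreal (c K) \<le> ennreal (c (K - U')) + ennreal (c (K - V'))"
    by (simp add: nonneg flip: ennreal_plus)
  also have "\<dots> \<le> inner_content U + inner_content V"
    using U'V' K by (intro add_mono inner_upper) auto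
  finally show "ennreal (c K) \<le> inner_content U + inner_content V" .
qed

lemma inner_UN_lessThan:
  fixes U :: "nat \<Rightarrow> 'a set"
  assumes "\<And>i. open (U i)"
  shows "inner_content (\<Union>i<n. U i) \<le> (\<Sum>i<n. inner_content (U i))"
proof (induction n)
  case 0
  show ?case by (simp add: inner_empty)
next
  case (Suc n)
  have "inner_content (\<Union>i<Suc n. U i) \<le> inner_content (\<Union>i<n. U i) + inner_content (U n)"
    using inner_Un[of "\<Union>i<n. U i" "U n"] assms by (simp add: lessThan_Suc Un_commute open_UN)
  also have "\<dots> \<le> (\<Sum>i<Suc n. inner_content (U i))"
    using Suc by (simp add: add_right_mono)
  finally show ?case .
qed

text \<open>Closed sets are compact here, so each \<open>K\<close> in the supremum lies in a finite
  subunion.\<close>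

lemma inner_UN:
  fixes U :: "nat \<Rightarrow> 'a set"
  assumes "\<And>i. open (U i)"
  shows "inner_content (\<Union>i. U i) \<le> (\<Sum>i. inner_content (U i))"
proof (rule inner_least)
  fix K assume K: "closed K" "K \<subseteq> (\<Union>i. U i)"
  then have "compact K"
    using compact_UNIV compact_Int_closed[of UNIV K] by simp
  then obtain C where C: "finite C" "K \<subseteq> (\<Union>i\<in>C. U i)"
    using compactE_image[of K UNIV U] assms K(2) by metis
  then obtain n where "C \<subseteq> {..<n}"
    using finite_nat_bounded by metis
  with C have "K \<subseteq> (\<Union>i<n. U i)"
    by blast
  with K have "ennreal (c K) \<le> inner_content (\<Union>i<n. U i)"
    by (intro inner_upper)
  also have "\<dots> \<le> (\<Sum>i<n. inner_content (U i))"
    using assms by (rule inner_UN_lessThan)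
  also have "\<dots> \<le> (\<Sum>i. inner_content (U i))"
    by (rule sum_le_suminf) auto
  finally show "ennreal (c K) \<le> (\<Sum>i. inner_content (U i))" .
qed

lemma outer_UN:
  fixes A :: "nat \<Rightarrow> 'a set"
  shows "outer_content (\<Union>i. A i) \<le> (\<Sum>i. outer_content (A i))"
proof (rule ennreal_le_epsilon)
  fix e :: real assume e: "e > 0"
  \<comment> \<open>The errors \<open>e * (1/2) ^ Suc i\<close> sum to \<open>e\<close>. The strict
    inequality rests on finiteness of \<open>outer_content (A i)\<close>.\<close>
  have "\<exists>U. open U \<and> A i \<subseteq> U \<and> inner_content U < outer_content (A i) + ennreal (e * (1/2) ^ Suc i)" for i
  proof -
    have "outer_content (A i) < outer_content (A i) + ennreal (e * (1/2) ^ Suc i)"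
      using outer_finite[of "A i"] e by (simp add: ennreal_zero_less_divide)
    then show ?thesis
      unfolding outer_content_def[of "A i"] INF_less_iff by auto
  qed
  then obtain U where U: "\<And>i. open (U i)" "\<And>i. A i \<subseteq> U i"
      "\<And>i. inner_content (U i) < outer_content (A i) + ennreal (e * (1/2) ^ Suc i)"
    by metis
  have "outer_content (\<Union>i. A i) \<le> inner_content (\<Union>i. U i)"
    using U by (intro outer_lower) auto
  also have "\<dots> \<le> (\<Sum>i. inner_content (U i))"
    using U(1) by (rule inner_UN)
  also have "\<dots> \<le> (\<Sum>i. outer_content (A i) + ennreal (e * (1/2) ^ Suc i))"
    using U(3) by (intro suminf_le) (auto intro: less_imp_le)
  also have "\<dots> = (\<Sum>i. outer_content (A i)) + (\<Sum>i. ennreal (e * (1/2) ^ Suc i))"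
    by (rule suminf_add[symmetric]) auto
  also have "(\<Sum>i. ennreal (e * (1/2) ^ Suc i)) = ennreal e"
    using sums_mult[OF power_half_series, of e] e
    by (intro suminf_ennreal_eq) auto
  finally show "outer_content (\<Union>i. A i) \<le> (\<Sum>i. outer_content (A i)) + ennreal e" .
qed

section \<open>Caratheodory's criterion for open sets\<close>

lemma outer_measure_space_outer: "outer_measure_space UNIV outer_content"
  unfolding outer_measure_space_def positive_def increasing_def countably_subadditive_def
  using outer_open[of "{}"] by (auto simp: inner_empty outer_mono outer_UN)

text \<open>For closed \<open>K\<close> inside \<open>U \<inter> W\<close>, the open set
  \<open>W - K\<close> covers \<open>A - U\<close>. A closed \<open>L\<close> inside
  \<open>W - K\<close> is disjoint from \<open>K\<close>, so additivity bounds
  \<open>c K + c L\<close> by the content of \<open>W\<close>. Taking suprema over \<open>L\<close>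
  and then over \<open>K\<close> gives the claim.\<close>

lemma outer_split_open:
  assumes "open U"
  shows "outer_content (U \<inter> A) + outer_content (A - U) \<le> outer_content A"
proof (rule outer_greatest)
  fix W assume W: "open W" "A \<subseteq> W"
  have "ennreal (c K) + outer_content (A - U) \<le> inner_content W" if K: "closed K" "K \<subseteq> U \<inter> W" for K
  proof -
    have "ennreal (c K) + outer_content (A - U) \<le> ennreal (c K) + inner_content (W - K)"
      using K W by (intro add_left_mono outer_lower) auto
    also have "\<dots> = (SUP L\<in>{L. closed L \<and> L \<subseteq> W - K}. ennreal (c K) + ennreal (c L))"
      unfolding inner_content_def by (rule ennreal_SUP_add_right) auto
    also have "\<dots> \<le> inner_content W"
    proof (rule SUP_least)
      fix L assume L: "L \<in> {L. closed L \<and> L \<subseteq> W - K}"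
      have "ennreal (c K) + ennreal (c L) = ennreal (c (K \<union> L))"
        using L by (subst additive) (auto simp: nonneg)
      also have "\<dots> \<le> inner_content W"
        using K L by (intro inner_upper) auto
      finally show "ennreal (c K) + ennreal (c L) \<le> inner_content W" .
    qed
    finally show ?thesis .
  qed
  then have "(SUP K\<in>{K. closed K \<and> K \<subseteq> U \<inter> W}. outer_content (A - U) + ennreal (c K)) \<le> inner_content W"
    by (intro SUP_least) (auto simp: add.commute)
  then have "inner_content (U \<inter> W) + outer_content (A - U) \<le> inner_content W"
    unfolding inner_content_def[of "U \<inter> W"]
    by (subst (asm) ennreal_SUP_add_right[symmetric]) (auto simp: add.commute)
  moreover have "outer_content (U \<inter> A) \<le> inner_content (U \<inter> W)"
    using W assms by (intro outer_lower) auto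
  ultimately show "outer_content (U \<inter> A) + outer_content (A - U) \<le> inner_content W"
    by (meson add_right_mono order_trans)
qed

lemma outer_Un: "outer_content (A \<union> B) \<le> outer_content A + outer_content B"
proof -
  define X where "X i = (if i = 0 then A else if i = 1 then B else {})" for i :: nat
  have "outer_content (X i) = 0" if "i \<notin> {..<2}" for i
    using that outer_open[of "{}"] by (auto simp: X_def inner_empty)
  then have "(\<Sum>i. outer_content (X i)) = (\<Sum>i<2. outer_content (X i))"
    by (intro suminf_finite) auto
  moreover have "A \<union> B = (\<Union>i. X i)"
    by (auto simp: X_def split: if_splits)
  ultimately show ?thesis
    using outer_UN[of X] by (simp add: X_def numeral_2_eq_2)
qed

lemma open_in_lambda_system:
  assumes "open U"
  shows "U \<in> lambda_system UNIV UNIV outer_content"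
proof -
  have "outer_content (U \<inter> A) + outer_content ((UNIV - U) \<inter> A) = outer_content A" for A
  proof (rule antisym)
    have "(UNIV - U) \<inter> A = A - U" by auto
    then show "outer_content (U \<inter> A) + outer_content ((UNIV - U) \<inter> A) \<le> outer_content A"
      using outer_split_open[OF assms] by simp
    have "A = (U \<inter> A) \<union> ((UNIV - U) \<inter> A)" by auto
    then show "outer_content A \<le> outer_content (U \<inter> A) + outer_content ((UNIV - U) \<inter> A)"
      using outer_Un by metis
  qed
  then show ?thesis
    by (simp add: lambda_system_def)
qed

text \<open>The sets that split every set additively form a sigma-algebra on which the outer content
  is a measure. It contains the open sets, hence all Borel sets.\<close>

lemma measure_space_outer: "measure_space UNIV (sets borel) outer_content"
proof -
  have ls: "measure_space UNIV (lambda_system UNIV UNIV outer_content) outer_content"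
    using sigma_algebra.caratheodory_lemma[OF sigma_algebra_Pow[of UNIV], of outer_content]
      outer_measure_space_outer by simp
  then have "sigma_algebra UNIV (lambda_system UNIV UNIV outer_content)"
    by (simp add: measure_space_def)
  then have "sigma_sets UNIV {U. open U} \<subseteq> lambda_system UNIV UNIV outer_content"
    by (rule sigma_algebra.sigma_sets_subset) (auto simp: open_in_lambda_system)
  then have "sets borel \<subseteq> lambda_system UNIV UNIV outer_content"
    by (simp add: borel_def)
  then show ?thesis
    using ls sets.sigma_algebra_axioms[of "borel :: 'a measure"]
    by (auto simp: measure_space_def positive_def countably_additive_def)
qed

section \<open>The Borel measure and its regularity\<close>

definition extension :: "'a measure" where
  "extension = measure_of UNIV (sets borel) outer_content"

lemma sets_extension: "sets extension = sets borel"
  unfolding extension_def using sets.sigma_sets_eq[of "borel :: 'a measure"]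
  by (simp add: sets_measure_of_conv)

lemma emeasure_extension: "B \<in> sets borel \<Longrightarrow> emeasure extension B = outer_content B"
  using measure_space_outer unfolding extension_def
  by (subst emeasure_measure_of_conv)
    (auto simp: measure_space_def sets.sigma_sets_eq[of "borel :: 'a measure", simplified])

lemma space_extension: "space extension = UNIV"
  using sets_eq_imp_space_eq[OF sets_extension] by simp

lemma prob_space_extension: "prob_space extension"
  by (rule prob_spaceI)
    (simp add: space_extension emeasure_extension outer_open inner_UNIV)

lemma outer_regular_extension:
  assumes "B \<in> sets borel"
  shows "emeasure extension B = (INF U\<in>{U. open U \<and> B \<subseteq> U}. emeasure extension U)"
  using assms by (simp add: emeasure_extension outer_open outer_content_def[of B])

text \<open>Inner regularity is outer regularity of the complement: if an open \<open>U\<close>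
  covers \<open>-B\<close> with excess below \<open>e\<close>, then \<open>-U\<close> is a closed,
  hence compact, subset of \<open>B\<close> that misses mass less than \<open>e\<close>.\<close>

lemma regular_extension: "regular_measure extension"
  unfolding regular_measure_def
proof (intro ballI conjI)
  interpret prob_space extension by (rule prob_space_extension)
  fix B assume "B \<in> sets extension"
  then have B: "B \<in> sets borel" by (simp add: sets_extension)
  then show "emeasure extension B = (INF U\<in>{U. open U \<and> B \<subseteq> U}. emeasure extension U)"
    by (rule outer_regular_extension)
  have mB: "-B \<in> sets borel"
    using B by (metis Compl_eq_Diff_UNIV sets.compl_sets space_borel)
  show "emeasure extension B = (SUP K\<in>{K. compact K \<and> K \<subseteq> B}. emeasure extension K)"
  proof (rule antisym)
    show "(SUP K\<in>{K. compact K \<and> K \<subseteq> B}. emeasure extension K) \<le> emeasure extension B"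
      using B by (intro SUP_least emeasure_mono) (auto simp: sets_extension)
    show "emeasure extension B \<le> (SUP K\<in>{K. compact K \<and> K \<subseteq> B}. emeasure extension K)"
    proof (rule ennreal_le_epsilon)
      fix e :: real assume e: "e > 0"
      have "emeasure extension (-B) < emeasure extension (-B) + ennreal e"
        using outer_finite[of "-B"] mB e by (simp add: emeasure_extension)
      then obtain U where U: "open U" "-B \<subseteq> U"
          and less: "emeasure extension U < emeasure extension (-B) + ennreal e"
        using outer_regular_extension[OF mB] INF_less_iff by (metis (mono_tags, lifting) mem_Collect_eq)
      have "measure extension U < measure extension (-B) + e"
        using less e by (simp add: emeasure_eq_measure ennreal_less_iff flip: ennreal_plus)
      moreover have "measure extension (-U) = 1 - measure extension U"
        using prob_compl[of U] U(1) by (simp add: sets_extension space_extension Compl_eq_Diff_UNIV)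
      moreover have "measure extension (-B) = 1 - measure extension B"
        using prob_compl[of B] B by (simp add: sets_extension space_extension Compl_eq_Diff_UNIV)
      ultimately have "measure extension B \<le> measure extension (-U) + e"
        by simp
      then have "emeasure extension B \<le> emeasure extension (-U) + ennreal e"
        using e by (simp add: emeasure_eq_measure flip: ennreal_plus)
      also have "\<dots> \<le> (SUP K\<in>{K. compact K \<and> K \<subseteq> B}. emeasure extension K) + ennreal e"
      proof (intro add_right_mono SUP_upper)
        have "compact (-U)"
          using compact_UNIV compact_Int_closed[of UNIV "-U"] U(1) by (simp add: closed_Compl)
        then show "-U \<in> {K. compact K \<and> K \<subseteq> B}"
          using U(2) by auto
      qed
      finally show "emeasure extension B \<le>
          (SUP K\<in>{K. compact K \<and> K \<subseteq> B}. emeasure extension K) + ennreal e" .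
    qed
  qed
qed

text \<open>Openness makes the measure of \<open>C\<close> its inner content, and closedness makes
  \<open>C\<close> itself a competitor in that supremum.\<close>

lemma measure_extension_clopen:
  assumes "open C" "closed C"
  shows "c C \<le> measure extension C"
proof -
  interpret prob_space extension by (rule prob_space_extension)
  have "ennreal (c C) \<le> emeasure extension C"
    using assms by (simp add: emeasure_extension outer_open inner_upper)
  then show ?thesis
    by (simp add: emeasure_eq_measure)
qed

end

section \<open>A minimax theorem with finitely additive strategies\<close>

text \<open>One round of the strategy: \<open>x\<close> is the accumulated payoff and
  \<open>y\<close> the new one. Expanding the square, the cross term has a favourable sign by the
  second assumption, and each coordinate adds at most 1.\<close>

lemma sum_neg_part_power2_le:
  fixes x y :: "'i \<Rightarrow> real"
  assumes "\<And>i. i \<in> F \<Longrightarrow> \<bar>y i\<bar> \<le> 1" "(\<Sum>i\<in>F. max 0 (- x i) * y i) \<ge> 0"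
  shows "(\<Sum>i\<in>F. (max 0 (- (x i + y i)))\<^sup>2) \<le> (\<Sum>i\<in>F. (max 0 (- x i))\<^sup>2) + real (card F)"
proof -
  have "(max 0 (- (x i + y i)))\<^sup>2 \<le> (max 0 (- x i))\<^sup>2 - 2 * (max 0 (- x i) * y i) + 1"
    if "i \<in> F" for i
  proof -
    \<comment> \<open>For \<open>x i < 0\<close> the negative part of the sum is the positive part
      of \<open>max 0 (- x i) - y i\<close>; otherwise it is at most
      \<open>\<bar>y i\<bar>\<close>.\<close>
    have "(max 0 (- (x i + y i)))\<^sup>2 \<le> (max 0 (- x i) - y i)\<^sup>2"
      by (intro iffD1[OF abs_le_square_iff]) (auto simp: max_def)
    also have "\<dots> = (max 0 (- x i))\<^sup>2 - 2 * (max 0 (- x i) * y i) + (y i)\<^sup>2"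
      by (simp add: power2_diff)
    also have "(y i)\<^sup>2 \<le> 1"
      using assms(1)[OF that] by (simp add: abs_square_le_1)
    finally show ?thesis by simp
  qed
  then have "(\<Sum>i\<in>F. (max 0 (- (x i + y i)))\<^sup>2)
      \<le> (\<Sum>i\<in>F. (max 0 (- x i))\<^sup>2 - 2 * (max 0 (- x i) * y i) + 1)"
    by (rule sum_mono)
  also have "\<dots> = (\<Sum>i\<in>F. (max 0 (- x i))\<^sup>2) - 2 * (\<Sum>i\<in>F. max 0 (- x i) * y i) + real (card F)"
    by (simp add: sum.distrib sum_subtractf sum_distrib_left)
  finally show ?thesis
    using assms(2) by simp
qed

text \<open>Blackwell's strategy: answering the weights given by the negative part of the accumulated
  payoff vector makes the squared distance to the positive orthant grow only linearly.\<close>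

lemma approachability:
  fixes g :: "'h \<Rightarrow> 'i \<Rightarrow> real"
  assumes bound: "\<And>h i. i \<in> F \<Longrightarrow> \<bar>g h i\<bar> \<le> 1"
    and response: "\<And>w. (\<And>i. w i \<ge> 0) \<Longrightarrow> \<exists>h. (\<Sum>i\<in>F. w i * g h i) \<ge> 0"
  shows "\<exists>hs. length hs = n \<and>
    (\<Sum>i\<in>F. (max 0 (- (\<Sum>h\<leftarrow>hs. g h i)))\<^sup>2) \<le> real n * real (card F)"
proof (induction n)
  case 0
  show ?case by simp
next
  case (Suc n)
  then obtain hs where hs: "length hs = n"
      "(\<Sum>i\<in>F. (max 0 (- (\<Sum>h\<leftarrow>hs. g h i)))\<^sup>2) \<le> real n * real (card F)"
    by blast
  obtain h where "(\<Sum>i\<in>F. max 0 (- (\<Sum>h\<leftarrow>hs. g h i)) * g h i) \<ge> 0"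
    using response[of "\<lambda>i. max 0 (- (\<Sum>h\<leftarrow>hs. g h i))"] by auto
  from sum_neg_part_power2_le[OF bound this] hs
  have "(\<Sum>i\<in>F. (max 0 (- (\<Sum>h\<leftarrow>h # hs. g h i)))\<^sup>2) \<le> real (Suc n) * real (card F)"
    by (simp add: algebra_simps)
  with hs(1) show ?case
    by (intro exI[of _ "h # hs"]) simp
qed

text \<open>The distance to the orthant after \<open>n\<close> rounds is at most the square root of
  \<open>n * card F\<close>, so the average shortfall tends to 0.\<close>

lemma approximate_minimax:
  fixes g :: "'h \<Rightarrow> 'i \<Rightarrow> real"
  assumes F: "finite F" and e: "e > 0"
    and bound: "\<And>h i. i \<in> F \<Longrightarrow> \<bar>g h i\<bar> \<le> 1"
    and response: "\<And>w. (\<And>i. w i \<ge> 0) \<Longrightarrow> \<exists>h. (\<Sum>i\<in>F. w i * g h i) \<ge> 0"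
  shows "\<exists>hs. hs \<noteq> [] \<and> (\<forall>i\<in>F. (\<Sum>h\<leftarrow>hs. g h i) \<ge> - e * real (length hs))"
proof -
  \<comment> \<open>This size makes \<open>n * card F\<close> at most \<open>(e * n)^2\<close>;
    being a successor, \<open>n\<close> gives a nonempty list.\<close>
  obtain n0 :: nat where n0: "real (card F) / e\<^sup>2 < real n0"
    using reals_Archimedean2 by blast
  define n where "n = Suc n0"
  have n: "real (card F) \<le> real n * e\<^sup>2"
    using n0 e by (simp add: n_def field_simps add_increasing)
  obtain hs where hs: "length hs = n"
      "(\<Sum>i\<in>F. (max 0 (- (\<Sum>h\<leftarrow>hs. g h i)))\<^sup>2) \<le> real n * real (card F)"
    using approachability[OF bound response] by blast
  have "(\<Sum>h\<leftarrow>hs. g h i) \<ge> - e * real (length hs)" if "i \<in> F" for i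
  proof -
    have "(max 0 (- (\<Sum>h\<leftarrow>hs. g h i)))\<^sup>2 \<le> (\<Sum>i\<in>F. (max 0 (- (\<Sum>h\<leftarrow>hs. g h i)))\<^sup>2)"
      using F that by (intro member_le_sum) auto
    also have "\<dots> \<le> real n * real (card F)"
      by (rule hs)
    also have "\<dots> \<le> real n * (real n * e\<^sup>2)"
      using n by (intro mult_left_mono) auto
    also have "\<dots> = (e * real n)\<^sup>2"
      by (simp add: power2_eq_square algebra_simps)
    finally have "max 0 (- (\<Sum>h\<leftarrow>hs. g h i)) \<le> e * real n"
      by (rule power2_le_imp_le) (use e in simp)
    then show ?thesis
      using hs(1) by simp
  qed
  moreover have "hs \<noteq> []"
    using hs(1) by (auto simp: n_def)
  ultimately show ?thesis by blast
qed

section \<open>Compactness and passage to infinitely many payoffs\<close>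

lemma compact_Pi_UNIV:
  fixes K :: "'i \<Rightarrow> 'a::topological_space set"
  assumes "\<And>i. compact (K i)"
  shows "compact (Pi UNIV K)"
  using assms compactin_PiE[of "\<lambda>_. euclidean" UNIV K]
  by (simp add: euclidean_product_topology PiE_UNIV_domain)

text \<open>The locale conditions as a subset of a product space. Asking only for finite additivity
  keeps it closed under pointwise limits.\<close>

definition fin_add_probs :: "('a set \<Rightarrow> real) set" where
  "fin_add_probs = {c. (\<forall>A. c A \<ge> 0) \<and> (\<forall>A B. A \<inter> B = {} \<longrightarrow> c (A \<union> B) = c A + c B) \<and> c UNIV = 1}"

text \<open>Each condition constrains finitely many coordinates and is closed, and all values lie in
  \<open>{0..1}\<close>: a closed subset of a Tychonoff cube.\<close>

lemma compact_fin_add_probs: "compact (fin_add_probs :: ('a set \<Rightarrow> real) set)"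
proof -
  have le1: "c A \<le> 1" if "c \<in> fin_add_probs" for c :: "'a set \<Rightarrow> real" and A
  proof -
    have "c UNIV = c A + c (- A)"
      using that unfolding fin_add_probs_def
      by (metis (mono_tags, lifting) Compl_disjoint Compl_partition mem_Collect_eq)
    then show ?thesis
      using that unfolding fin_add_probs_def by (smt (verit) mem_Collect_eq)
  qed
  have "closed {c :: 'a set \<Rightarrow> real. c (A \<union> B) = c A + c B}" for A B
    by (intro closed_Collect_eq continuous_on_add continuous_on_product_coordinates)
  moreover have "closed {c :: 'a set \<Rightarrow> real. c UNIV = 1}"
    by (intro closed_Collect_eq continuous_on_const continuous_on_product_coordinates)
  moreover have "closed {c :: 'a set \<Rightarrow> real. c A \<ge> 0}" for A
    by (intro closed_Collect_le continuous_on_const continuous_on_product_coordinates)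
  ultimately have "closed ((\<Inter>A. {c. c A \<ge> 0}) \<inter>
      (\<Inter>(A, B)\<in>{(A, B). A \<inter> B = {}}. {c. c (A \<union> B) = c A + c B}) \<inter>
      {c :: 'a set \<Rightarrow> real. c UNIV = 1})"
    by (intro closed_Int closed_INT) auto
  also have "(\<Inter>A. {c. c A \<ge> 0}) \<inter>
      (\<Inter>(A, B)\<in>{(A, B). A \<inter> B = {}}. {c. c (A \<union> B) = c A + c B}) \<inter>
      {c :: 'a set \<Rightarrow> real. c UNIV = 1} = fin_add_probs"
    unfolding fin_add_probs_def by auto
  finally have "closed (fin_add_probs :: ('a set \<Rightarrow> real) set)" .
  moreover have "compact (Pi UNIV (\<lambda>_ :: 'a set. {0..1::real}))"
    by (rule compact_Pi_UNIV) simp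
  moreover have "fin_add_probs = Pi UNIV (\<lambda>_ :: 'a set. {0..1::real}) \<inter> fin_add_probs"
    using le1 by (auto simp: fin_add_probs_def)
  ultimately show ?thesis
    by (metis compact_Int_closed)
qed

lemma empirical_in_fin_add_probs:
  assumes "hs \<noteq> []"
  shows "(\<lambda>A. (\<Sum>h\<leftarrow>hs. indicator A h) / real (length hs)) \<in> fin_add_probs"
proof -
  have "(\<Sum>h\<leftarrow>hs. indicator (A \<union> B) h :: real) = (\<Sum>h\<leftarrow>hs. indicator A h) + (\<Sum>h\<leftarrow>hs. indicator B h)"
    if "A \<inter> B = {}" for A B
    using that by (simp add: indicator_add[symmetric] sum_list_addf)
  moreover have "(\<Sum>h\<leftarrow>hs. indicator A h :: real) \<ge> 0" for A
    by (rule sum_list_nonneg) auto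
  ultimately show ?thesis
    using assms by (auto simp: fin_add_probs_def add_divide_distrib sum_list_triv)
qed

text \<open>The constraints \<open>c (C i) \<ge> v - e\<close> are closed, and an empirical
  distribution meets any finitely many of them. By compactness some \<open>c\<close> meets them all,
  and \<open>e\<close> may tend to 0.\<close>

theorem fin_add_minimax:
  fixes C :: "'i \<Rightarrow> 'a set" and v :: real
  assumes v: "0 \<le> v" "v \<le> 1"
    and response: "\<And>F w. finite F \<Longrightarrow> F \<subseteq> I \<Longrightarrow> (\<And>i. w i \<ge> 0) \<Longrightarrow>
      \<exists>h. (\<Sum>i\<in>F. w i * (indicator (C i) h - v)) \<ge> 0"
  shows "\<exists>c\<in>fin_add_probs. \<forall>i\<in>I. c (C i) \<ge> v"
proof -
  let ?K = "\<lambda>(i, e). {c. c (C i) \<ge> v - e}"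
  have "fin_add_probs \<inter> (\<Inter>p\<in>I \<times> {0<..}. ?K p) \<noteq> {}"
  proof (rule compact_imp_fip_image[OF compact_fin_add_probs])
    show "closed (?K p)" for p
      by (cases p) (auto intro!: closed_Collect_le continuous_on_const continuous_on_product_coordinates)
    fix P :: "('i \<times> real) set" assume P: "finite P" "P \<subseteq> I \<times> {0<..}"
    \<comment> \<open>The smallest tolerance serves every constraint in \<open>P\<close>; the
      inserted 1 covers empty \<open>P\<close>.\<close>
    define e where "e = Min (insert 1 (snd ` P))"
    have e: "e > 0" "\<And>p. p \<in> P \<Longrightarrow> e \<le> snd p"
      using P by (auto simp: e_def)
    have "\<bar>indicator (C i) h - v\<bar> \<le> 1" for i h
      using v by (auto simp: indicator_def)
    then have "\<exists>hs. hs \<noteq> [] \<and>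
        (\<forall>i\<in>fst ` P. (\<Sum>h\<leftarrow>hs. indicator (C i) h - v) \<ge> - e * real (length hs))"
      using P e(1) by (intro approximate_minimax response) auto
    then obtain hs where hs: "hs \<noteq> []"
        "\<And>i. i \<in> fst ` P \<Longrightarrow> (\<Sum>h\<leftarrow>hs. indicator (C i) h - v) \<ge> - e * real (length hs)"
      by blast
    let ?c = "\<lambda>A. (\<Sum>h\<leftarrow>hs. indicator A h) / real (length hs)"
    have "?c (C i) \<ge> v - d" if "(i, d) \<in> P" for i d
    proof -
      have "(\<Sum>h\<leftarrow>hs. indicator (C i) h - v) = (\<Sum>h\<leftarrow>hs. indicator (C i) h) - v * real (length hs)"
        by (simp add: sum_list_subtractf sum_list_triv)
      moreover have "- e * real (length hs) \<le> (\<Sum>h\<leftarrow>hs. indicator (C i) h - v)"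
        using that by (intro hs(2)) force
      moreover have "real (length hs) > 0"
        using hs(1) by simp
      ultimately have "?c (C i) \<ge> v - e"
        by (simp add: pos_le_divide_eq left_diff_distrib)
      with e(2)[OF that] show ?thesis by simp
    qed
    then have "?c \<in> fin_add_probs \<inter> (\<Inter>p\<in>P. ?K p)"
      using empirical_in_fin_add_probs[OF hs(1)] by blast
    then show "fin_add_probs \<inter> (\<Inter>p\<in>P. ?K p) \<noteq> {}"
      by blast
  qed
  then obtain c where c: "c \<in> fin_add_probs" "\<And>i e. i \<in> I \<Longrightarrow> e > 0 \<Longrightarrow> c (C i) \<ge> v - e"
    by auto
  have "c (C i) \<ge> v" if "i \<in> I" for i
  proof (rule field_le_epsilon)
    show "v \<le> c (C i) + e" if "e > 0" for e
      using c(2)[OF \<open>i \<in> I\<close> that] by simp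
  qed
  with c(1) show ?thesis by blast
qed

section \<open>The consistency game\<close>

lemma compact_UNIV_hypotheses: "compact (UNIV :: ('x \<Rightarrow> bool) set)"
  using compact_Pi_UNIV[of "\<lambda>_ :: 'x. UNIV :: bool set"] by (simp add: finite_imp_compact)

lemma normal_space_hypotheses: "normal_space (euclidean :: ('x \<Rightarrow> bool) topology)"
proof -
  have "Hausdorff_space (euclidean :: bool topology)"
    unfolding Hausdorff_space_def
  proof (intro allI impI)
    fix x y :: bool assume "x \<in> topspace euclidean \<and> y \<in> topspace euclidean \<and> x \<noteq> y"
    then show "\<exists>U V. openin euclidean U \<and> openin euclidean V \<and> x \<in> U \<and> y \<in> V \<and> disjnt U V"
      by (intro exI[of _ "{x}"] exI[of _ "{y}"]) (auto simp: discrete_topology_class.open_discrete disjnt_def)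
  qed
  then have "Hausdorff_space (euclidean :: ('x \<Rightarrow> bool) topology)"
    unfolding euclidean_product_topology[symmetric] by (simp add: Hausdorff_space_product_topology)
  moreover have "compact_space (euclidean :: ('x \<Rightarrow> bool) topology)"
    using compact_UNIV_hypotheses by (simp add: compact_space_def)
  ultimately show ?thesis
    using compact_Hausdorff_or_regular_imp_normal_space by blast
qed

lemma consistent_iff: "consistent h S \<longleftrightarrow> (\<forall>p\<in>set S. h (fst p) = snd p)"
  by (simp add: consistent_def split_beta)

lemma closed_coordinate: "closed ((\<lambda>h :: 'x \<Rightarrow> bool. h x) -` A)"
  by (intro closed_vimage continuous_on_product_coordinates) (simp add: closed_def discrete_topology_class.open_discrete)

text \<open>A dataset constrains finitely many coordinates, so this is a finite intersection of
  clopen cylinders.\<close>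

lemma clopen_consistent: "open {h. consistent h S}" "closed {h. consistent h S}"
proof -
  have eq: "{h. consistent h S} = (\<Inter>p\<in>set S. (\<lambda>h. h (fst p)) -` {snd p})"
    by (simp add: set_eq_iff consistent_iff)
  show "open {h. consistent h S}"
    unfolding eq by (intro open_INT ballI
        open_vimage continuous_on_product_coordinates discrete_topology_class.open_discrete) auto
  show "closed {h. consistent h S}"
    unfolding eq by (intro closed_INT ballI closed_coordinate)
qed

lemma consistent_in_borel [measurable]: "{h. consistent h S} \<in> sets borel"
  by (intro borel_open clopen_consistent)

section \<open>Pure strategies and best responses\<close>

text \<open>Makes single hypotheses available as strategies. Regularity is witnessed by
  \<open>UNIV\<close> or the open set \<open>- {h}\<close> from outside and by the compact set
  \<open>{h}\<close> from inside.\<close>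

lemma return_in_hyp_dists: "return borel h \<in> hyp_dists"
proof -
  have "regular_measure (return borel h)"
    unfolding regular_measure_def
  proof (intro ballI conjI)
    fix B :: "('a \<Rightarrow> bool) set" assume B: "B \<in> sets (return borel h)"
    have "{h} = (\<Inter>x. (\<lambda>g. g x) -` {h x})"
      by auto
    also have "closed \<dots>"
      by (intro closed_INT ballI closed_coordinate)
    finally have "closed {h}" .
    show "emeasure (return borel h) B = (INF U\<in>{U. open U \<and> B \<subseteq> U}. emeasure (return borel h) U)"
    proof (rule antisym)
      show "emeasure (return borel h) B \<le> (INF U\<in>{U. open U \<and> B \<subseteq> U}. emeasure (return borel h) U)"
        by (intro INF_greatest emeasure_mono) auto
      show "(INF U\<in>{U. open U \<and> B \<subseteq> U}. emeasure (return borel h) U) \<le> emeasure (return borel h) B"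
      proof (cases "h \<in> B")
        case True
        then show ?thesis
          using B by (intro INF_lower2[of UNIV]) auto
      next
        case False
        with \<open>closed {h}\<close> B show ?thesis
          by (intro INF_lower2[of "- {h}"]) (auto simp: closed_def)
      qed
    qed
    show "emeasure (return borel h) B = (SUP K\<in>{K. compact K \<and> K \<subseteq> B}. emeasure (return borel h) K)"
    proof (rule antisym)
      show "(SUP K\<in>{K. compact K \<and> K \<subseteq> B}. emeasure (return borel h) K) \<le> emeasure (return borel h) B"
        using B by (intro SUP_least emeasure_mono) auto
      show "emeasure (return borel h) B \<le> (SUP K\<in>{K. compact K \<and> K \<subseteq> B}. emeasure (return borel h) K)"
      proof (cases "h \<in> B")
        case True
        with \<open>closed {h}\<close> B show ?thesis
          by (intro SUP_upper2[of "{h}"]) auto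
      next
        case False
        with B show ?thesis by simp
      qed
    qed
  qed
  then show ?thesis
    by (simp add: hyp_dists_def prob_space_return)
qed

lemma game_value_eq_sum:
  assumes "\<mu> \<in> hyp_dists" "finite (set_pmf \<nu>)"
  shows "game_value \<mu> \<nu> = (\<Sum>S\<in>set_pmf \<nu>. pmf \<nu> S * measure \<mu> {h. consistent h S})"
proof -
  have [simp]: "space \<mu> = UNIV"
    using assms(1) sets_eq_imp_space_eq[of \<mu> borel] by (simp add: hyp_dists_def)
  have "(\<integral>h. of_bool (consistent h S) \<partial>\<mu>) = measure \<mu> {h. consistent h S}" for S
  proof -
    have "(\<lambda>h. of_bool (consistent h S) :: real) = indicator {h. consistent h S}"
      by (auto simp: indicator_def)
    then show ?thesis by simp
  qed
  then show ?thesis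
    unfolding game_value_def using assms(2)
    by (subst integral_measure_pmf_real[of "set_pmf \<nu>"]) (auto simp: mult.commute)
qed

definition payoff :: "('x \<Rightarrow> bool) \<Rightarrow> ('x \<times> bool) list pmf \<Rightarrow> real" where
  "payoff h \<nu> = (\<Sum>S\<in>set_pmf \<nu>. pmf \<nu> S * indicator {h. consistent h S} h)"

lemma game_value_return:
  "finite (set_pmf \<nu>) \<Longrightarrow> game_value (return borel h) \<nu> = payoff h \<nu>"
  by (simp add: game_value_eq_sum return_in_hyp_dists payoff_def measure_return)

text \<open>The payoff depends only on which datasets of the finite support \<open>h\<close> fits,
  so it takes finitely many values.\<close>

lemma payoff_attains_max:
  assumes "finite (set_pmf \<nu>)"
  shows "\<exists>h. \<forall>h'. payoff h' \<nu> \<le> payoff h \<nu>"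
proof -
  let ?A = "range (\<lambda>h. payoff h \<nu>)"
  have "?A \<subseteq> (\<lambda>T. \<Sum>S\<in>T. pmf \<nu> S) ` Pow (set_pmf \<nu>)"
  proof (intro image_subsetI)
    fix h :: "'a \<Rightarrow> bool"
    have "payoff h \<nu> = (\<Sum>S\<in>{S \<in> set_pmf \<nu>. consistent h S}. pmf \<nu> S)"
      unfolding payoff_def using assms
      by (intro sum.mono_neutral_cong_right) auto
    then show "payoff h \<nu> \<in> (\<lambda>T. \<Sum>S\<in>T. pmf \<nu> S) ` Pow (set_pmf \<nu>)"
      by blast
  qed
  then have fin: "finite ?A"
    using assms by (meson finite_Pow_iff finite_imageI finite_subset)
  then have "Max ?A \<in> ?A"
    by (intro Max_in) auto
  then obtain h where h: "Max ?A = payoff h \<nu>"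
    by blast
  have "payoff h' \<nu> \<le> payoff h \<nu>" for h'
    using Max_ge[OF fin, of "payoff h' \<nu>"] unfolding h by simp
  then show ?thesis by blast
qed

text \<open>Stated for any sigma-algebra containing the consistency sets, so that it covers both
  Borel measures and the coin-flip distribution below.\<close>

lemma average_le_payoff_bound:
  assumes "prob_space M" "space M = UNIV" "\<And>S. {h. consistent h S} \<in> sets M"
    and "finite (set_pmf \<nu>)" "\<And>h. payoff h \<nu> \<le> b"
  shows "(\<Sum>S\<in>set_pmf \<nu>. pmf \<nu> S * measure M {h. consistent h S}) \<le> b"
proof -
  interpret prob_space M by fact
  have int: "integrable M (\<lambda>h. pmf \<nu> S * indicator {h. consistent h S} h)" for S
    using assms(3) by (intro integrable_mult_right integrable_real_indicator) (auto simp: less_top[symmetric])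
  have "(\<Sum>S\<in>set_pmf \<nu>. pmf \<nu> S * measure M {h. consistent h S}) = (\<integral>h. payoff h \<nu> \<partial>M)"
    unfolding payoff_def using int assms(2) by (subst Bochner_Integration.integral_sum) auto
  also have "\<dots> \<le> (\<integral>h. b \<partial>M)"
    using assms(5) int unfolding payoff_def
    by (intro integral_mono Bochner_Integration.integrable_sum) auto
  finally show ?thesis
    by (simp add: prob_space)
qed

section \<open>Random labellings and the lower bound \<open>(1/2) ^ m\<close>\<close>

text \<open>Consistency prescribes one fair coin for each distinct point of \<open>S\<close>. There
  are at most \<open>m\<close> of them, fewer if points repeat.\<close>

lemma prob_consistent_ge:
  assumes D: "finite D" "fst ` set S \<subseteq> D" and S: "consistent h0 S" "length S = m"
  shows "measure_pmf.prob (Pi_pmf D False (\<lambda>_. bernoulli_pmf (1/2))) {h. consistent h S} \<ge> (1/2) ^ m"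
proof -
  let ?B = "\<lambda>x. if x \<in> fst ` set S then {h0 x} else UNIV"
  have "consistent h S \<longleftrightarrow> (\<forall>x\<in>fst ` set S. h x = h0 x)" for h
    using S(1) by (simp add: consistent_iff)
  moreover have "h \<in> Pi D ?B \<longleftrightarrow> (\<forall>x\<in>fst ` set S. h x = h0 x)" for h
  proof -
    have "h \<in> Pi D ?B \<longleftrightarrow> (\<forall>x\<in>D. x \<in> fst ` set S \<longrightarrow> h x = h0 x)"
      unfolding Pi_iff by (intro ball_cong refl) simp
    with D(2) show ?thesis by blast
  qed
  ultimately have "{h. consistent h S} = Pi D ?B"
    by (simp only: set_eq_iff mem_Collect_eq simp_thms)
  then have "measure_pmf.prob (Pi_pmf D False (\<lambda>_. bernoulli_pmf (1/2))) {h. consistent h S} =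
      (\<Prod>x\<in>D. measure_pmf.prob (bernoulli_pmf (1/2)) (?B x))"
    using D(1) by (simp add: measure_Pi_pmf_Pi)
  also have "\<dots> = (\<Prod>x\<in>D. if x \<in> fst ` set S then 1/2 else 1)"
  proof (rule prod.cong)
    show "measure_pmf.prob (bernoulli_pmf (1/2)) (?B x) = (if x \<in> fst ` set S then 1/2 else 1)" for x
      by (cases "h0 x") (auto simp: measure_pmf_single)
  qed simp
  also have "\<dots> = (1/2) ^ card (fst ` set S)"
    using D by (simp add: prod.If_cases Int_absorb1)
  also have "\<dots> \<ge> (1/2) ^ m"
    using card_length[of "map fst S"] S(2) by (intro power_decreasing) auto
  finally show ?thesis .
qed

text \<open>A random labelling of all points in the support has average payoff at least
  \<open>(1/2) ^ m\<close>, and the best hypothesis does no worse than the average. It need not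
  belong to \<open>H\<close>.\<close>

lemma payoff_ge_power_half:
  assumes "\<nu> \<in> data_dists H m"
  shows "\<exists>h. payoff h \<nu> \<ge> (1/2) ^ m"
proof -
  have fin: "finite (set_pmf \<nu>)" and V: "\<And>S. S \<in> set_pmf \<nu> \<Longrightarrow> length S = m \<and> realizable H S"
    using assms by (auto simp: data_dists_def realizable_datasets_def)
  define D where "D = (\<Union>S\<in>set_pmf \<nu>. fst ` set S)"
  have D: "finite D"
    using fin by (simp add: D_def)
  let ?q = "Pi_pmf D False (\<lambda>_. bernoulli_pmf (1/2))"
  obtain h where h: "\<And>h'. payoff h' \<nu> \<le> payoff h \<nu>"
    using payoff_attains_max[OF fin] by blast
  have "(1/2) ^ m = (\<Sum>S\<in>set_pmf \<nu>. pmf \<nu> S * (1/2) ^ m)"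
    using sum_pmf_eq_1[OF fin order_refl] by (simp flip: sum_distrib_right)
  also have "\<dots> \<le> (\<Sum>S\<in>set_pmf \<nu>. pmf \<nu> S * measure_pmf.prob ?q {h. consistent h S})"
  proof (intro sum_mono mult_left_mono)
    fix S assume "S \<in> set_pmf \<nu>"
    with V obtain h0 where "consistent h0 S" "length S = m"
      by (auto simp: realizable_def)
    with D \<open>S \<in> set_pmf \<nu>\<close> show "(1/2) ^ m \<le> measure_pmf.prob ?q {h. consistent h S}"
      by (intro prob_consistent_ge) (auto simp: D_def)
  qed simp
  also have "\<dots> \<le> payoff h \<nu>"
    using h fin by (intro average_le_payoff_bound) (auto simp: measure_pmf.prob_space_axioms)
  finally show ?thesis by blast
qed

text \<open>Mixing cannot beat the best hypothesis, and its point mass is an admissible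
  strategy.\<close>

lemma SUP_game_value_eq_payoff:
  assumes "finite (set_pmf \<nu>)"
  shows "\<exists>h. (SUP \<mu>\<in>hyp_dists. ereal (game_value \<mu> \<nu>)) = ereal (payoff h \<nu>)"
proof -
  obtain h where h: "\<And>h'. payoff h' \<nu> \<le> payoff h \<nu>"
    using payoff_attains_max[OF assms] by blast
  have "(SUP \<mu>\<in>hyp_dists. ereal (game_value \<mu> \<nu>)) = ereal (payoff h \<nu>)"
  proof (rule antisym)
    show "(SUP \<mu>\<in>hyp_dists. ereal (game_value \<mu> \<nu>)) \<le> ereal (payoff h \<nu>)"
    proof (rule SUP_least)
      fix \<mu> :: "('a \<Rightarrow> bool) measure" assume \<mu>: "\<mu> \<in> hyp_dists"
      then have "prob_space \<mu>" "sets \<mu> = sets borel" "space \<mu> = UNIV"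
        using sets_eq_imp_space_eq[of \<mu> borel] by (auto simp: hyp_dists_def)
      then show "ereal (game_value \<mu> \<nu>) \<le> ereal (payoff h \<nu>)"
        using h assms \<mu> by (simp add: game_value_eq_sum average_le_payoff_bound)
    qed
    show "ereal (payoff h \<nu>) \<le> (SUP \<mu>\<in>hyp_dists. ereal (game_value \<mu> \<nu>))"
      using assms by (intro SUP_upper2[OF return_in_hyp_dists[of h]]) (simp add: game_value_return)
  qed
  then show ?thesis by blast
qed

section \<open>Strong duality and attainment\<close>

text \<open>Normalising the weights gives a dataset distribution; a good answer to it is a good
  answer to the weights.\<close>

lemma weighted_response:
  assumes v: "\<And>\<nu>. \<nu> \<in> data_dists H m \<Longrightarrow> \<exists>h. payoff h \<nu> \<ge> v"
    and F: "finite F" "F \<subseteq> realizable_datasets H m" and w: "\<And>S. w S \<ge> 0"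
  shows "\<exists>h. (\<Sum>S\<in>F. w S * (indicator {h. consistent h S} h - v)) \<ge> 0"
proof (cases "sum w F = 0")
  case True
  then have "\<forall>S\<in>F. w S = 0"
    using F(1) w by (simp add: sum_nonneg_eq_0_iff)
  then show ?thesis by simp
next
  case False
  then have pos: "sum w F > 0"
    using w by (simp add: order_less_le sum_nonneg)
  define f where "f S = (if S \<in> F then w S / sum w F else 0)" for S
  have nn: "f S \<ge> 0" for S
    using w pos by (simp add: f_def)
  have "(\<integral>\<^sup>+S. ennreal (f S) \<partial>count_space UNIV) = (\<Sum>S\<in>F. ennreal (f S))"
    using F(1) by (intro nn_integral_count_space') (auto simp: f_def)
  also have "\<dots> = ennreal (\<Sum>S\<in>F. f S)"
    by (rule sum_ennreal) (rule nn)
  also have "(\<Sum>S\<in>F. f S) = 1"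
    using pos by (simp add: f_def flip: sum_divide_distrib)
  finally have total: "(\<integral>\<^sup>+S. ennreal (f S) \<partial>count_space UNIV) = 1" by simp
  define \<nu> where "\<nu> = embed_pmf f"
  have pmf: "pmf \<nu> S = f S" for S
    unfolding \<nu>_def by (rule pmf_embed_pmf[OF nn total])
  have supp: "set_pmf \<nu> \<subseteq> F"
    by (auto simp: set_pmf_eq pmf f_def split: if_splits)
  then have "\<nu> \<in> data_dists H m"
    using F by (auto simp: data_dists_def intro: finite_subset)
  with v obtain h where h: "v \<le> payoff h \<nu>" by blast
  \<comment> \<open>The support omits the datasets of weight 0, whose terms vanish.\<close>
  have "payoff h \<nu> = (\<Sum>S\<in>F. f S * indicator {h. consistent h S} h)"
    unfolding payoff_def pmf using F(1) supp
    by (intro sum.mono_neutral_left) (auto simp: set_pmf_eq pmf)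
  also have "\<dots> = (\<Sum>S\<in>F. w S * indicator {h. consistent h S} h) / sum w F"
    by (simp add: f_def sum_divide_distrib)
  finally have "v * sum w F \<le> (\<Sum>S\<in>F. w S * indicator {h. consistent h S} h)"
    using h pos by (simp add: pos_le_divide_eq)
  then have "(\<Sum>S\<in>F. w S * (indicator {h. consistent h S} h - v)) \<ge> 0"
    by (simp add: right_diff_distrib sum_subtractf sum_distrib_right mult.commute flip: sum_distrib_left)
  then show ?thesis by blast
qed

lemma game_value_ge:
  assumes "\<mu> \<in> hyp_dists" "\<nu> \<in> data_dists H m"
    and "\<And>S. S \<in> realizable_datasets H m \<Longrightarrow> v \<le> measure \<mu> {h. consistent h S}"
  shows "v \<le> game_value \<mu> \<nu>"
proof -
  have fin: "finite (set_pmf \<nu>)" and sub: "set_pmf \<nu> \<subseteq> realizable_datasets H m"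
    using assms(2) by (auto simp: data_dists_def)
  have "v = (\<Sum>S\<in>set_pmf \<nu>. pmf \<nu> S * v)"
    using sum_pmf_eq_1[OF fin order_refl] by (simp flip: sum_distrib_right)
  also have "\<dots> \<le> game_value \<mu> \<nu>"
    unfolding game_value_eq_sum[OF assms(1) fin]
    using sub assms(3) by (intro sum_mono mult_left_mono) auto
  finally show ?thesis .
qed

text \<open>The minimax theorem gives a finitely additive solution. Its regular extension keeps the
  bounds because the consistency sets are clopen.\<close>

lemma optimal_hyp_dist:
  assumes v: "0 \<le> v" "v \<le> 1"
    and "\<And>\<nu>. \<nu> \<in> data_dists H m \<Longrightarrow> \<exists>h. payoff h \<nu> \<ge> v"
  shows "\<exists>\<mu>\<in>hyp_dists. \<forall>\<nu>\<in>data_dists H m. v \<le> game_value \<mu> \<nu>"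
proof -
  obtain c where c: "c \<in> fin_add_probs"
      "\<And>S. S \<in> realizable_datasets H m \<Longrightarrow> v \<le> c {h. consistent h S}"
    using fin_add_minimax[OF v, where I = "realizable_datasets H m" and C = "\<lambda>S. {h. consistent h S}",
        OF weighted_response[where H = H and m = m, OF assms(3)]] by blast
  interpret finitely_additive_prob c
    using c(1) compact_UNIV_hypotheses normal_space_hypotheses
    by unfold_locales (auto simp: fin_add_probs_def)
  have "extension \<in> hyp_dists"
    by (simp add: hyp_dists_def prob_space_extension sets_extension regular_extension)
  moreover have "v \<le> measure extension {h. consistent h S}" if "S \<in> realizable_datasets H m" for S
    using c(2)[OF that] measure_extension_clopen[OF clopen_consistent] by (rule order_trans)
  ultimately show ?thesis
    using game_value_ge by blast
qed

text \<open>Repeating one example labelled by a member of \<open>H\<close> gives a realizable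
  dataset of any size, 0 included.\<close>

lemma data_dists_nonempty:
  assumes "H \<noteq> {}"
  shows "data_dists H m \<noteq> {}"
proof -
  obtain h where "h \<in> H"
    using assms by blast
  then have "replicate m (undefined, h undefined) \<in> realizable_datasets H m"
    by (auto simp: realizable_datasets_def realizable_def consistent_def)
  then have "return_pmf (replicate m (undefined, h undefined)) \<in> data_dists H m"
    by (simp add: data_dists_def)
  then show ?thesis by blast
qed

lemma payoff_le_1:
  assumes "finite (set_pmf \<nu>)"
  shows "payoff h \<nu> \<le> 1"
proof -
  have "payoff h \<nu> \<le> (\<Sum>S\<in>set_pmf \<nu>. pmf \<nu> S)"
    unfolding payoff_def by (intro sum_mono) (simp add: mult_left_le indicator_def)
  then show ?thesis
    using sum_pmf_eq_1[OF assms order_refl] by simp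
qed

theorem mainTheorem6:
  fixes H :: "('x \<Rightarrow> bool) set" and m :: nat
  shows "omega_star H m = chi_star H m \<and> chi_star H m \<le> ereal (2 ^ m) \<and>
         (\<exists>\<mu>\<in>hyp_dists. (INF \<nu>\<in>data_dists H m. ereal (game_value \<mu> \<nu>)) = ereal_recip (chi_star H m))"
proof (cases "H = {}")
  case True
  \<comment> \<open>Without datasets all infima are infinite, so both numbers are 0 and every
    \<open>\<mu>\<close> attains the value.\<close>
  then have "data_dists H m = {}"
    using set_pmf_not_empty by (auto simp: data_dists_def realizable_datasets_def realizable_def)
  moreover have "(hyp_dists :: ('x \<Rightarrow> bool) measure set) \<noteq> {}"
    using return_in_hyp_dists by blast
  ultimately show ?thesis
    by (auto simp: omega_star_def chi_star_def inv_chi_star_def inv_omega_star_def ereal_recip_def top_ereal_def)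
next
  case False
  let ?val = "\<lambda>\<mu>. INF \<nu>\<in>data_dists H m. ereal (game_value \<mu> \<nu>)"
  have SUP_val: "\<exists>h. (SUP \<mu>\<in>hyp_dists. ereal (game_value \<mu> \<nu>)) = ereal (payoff h \<nu>)"
    if "\<nu> \<in> data_dists H m" for \<nu>
    using that SUP_game_value_eq_payoff by (auto simp: data_dists_def)
  have ge: "ereal ((1/2) ^ m) \<le> inv_omega_star H m"
    unfolding inv_omega_star_def
  proof (rule INF_greatest)
    fix \<nu> assume \<nu>: "\<nu> \<in> data_dists H m"
    then obtain h where "(1/2) ^ m \<le> payoff h \<nu>"
      using payoff_ge_power_half by blast
    then show "ereal ((1/2) ^ m) \<le> (SUP \<mu>\<in>hyp_dists. ereal (game_value \<mu> \<nu>))"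
      using \<nu> by (intro SUP_upper2[OF return_in_hyp_dists[of h]]) (simp add: game_value_return data_dists_def)
  qed
  obtain \<nu>0 where \<nu>0: "\<nu>0 \<in> data_dists H m"
    using data_dists_nonempty[OF False] by blast
  have "inv_omega_star H m \<le> (SUP \<mu>\<in>hyp_dists. ereal (game_value \<mu> \<nu>0))"
    unfolding inv_omega_star_def using \<nu>0 by (rule INF_lower)
  also have "\<dots> \<le> 1"
    using SUP_val[OF \<nu>0] \<nu>0 by (auto simp: data_dists_def payoff_le_1)
  finally have le: "inv_omega_star H m \<le> 1" .
  \<comment> \<open>The value lies between \<open>(1/2) ^ m\<close> and 1, so it is a positive real
    and the reciprocal is the ordinary one.\<close>
  obtain r where r: "inv_omega_star H m = ereal r"
    using ge le by (cases "inv_omega_star H m") auto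
  have r_bounds: "(1/2) ^ m \<le> r" "r \<le> 1"
    using ge le r by auto
  then have r_pos: "r > 0"
    by (smt (verit) zero_less_power half_gt_zero)
  \<comment> \<open>As the supremum over \<open>\<mu>\<close> is a payoff, the bound by
    \<open>r\<close> is met by an actual hypothesis.\<close>
  have "\<exists>h. r \<le> payoff h \<nu>" if "\<nu> \<in> data_dists H m" for \<nu>
  proof -
    have "ereal r \<le> (SUP \<mu>\<in>hyp_dists. ereal (game_value \<mu> \<nu>))"
      unfolding r[symmetric] inv_omega_star_def using that by (rule INF_lower)
    then show ?thesis
      using SUP_val[OF that] by auto
  qed
  then obtain \<mu> where \<mu>: "\<mu> \<in> hyp_dists" "\<And>\<nu>. \<nu> \<in> data_dists H m \<Longrightarrow> r \<le> game_value \<mu> \<nu>"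
    using optimal_hyp_dist[of r H m] r_pos r_bounds by auto
  have "ereal r \<le> ?val \<mu>"
    using \<mu>(2) by (intro INF_greatest) simp
  moreover have "?val \<mu> \<le> inv_chi_star H m"
    unfolding inv_chi_star_def using \<mu>(1) by (rule SUP_upper)
  \<comment> \<open>Weak duality closes the chain from \<open>r\<close> through
    \<open>?val \<mu>\<close> and \<open>inv_chi_star H m\<close> back to \<open>r\<close>, which
    yields equality and attainment together.\<close>
  moreover have "inv_chi_star H m \<le> ereal r"
    unfolding r[symmetric] inv_chi_star_def inv_omega_star_def
    by (intro SUP_least INF_greatest) (meson INF_lower SUP_upper order_trans)
  ultimately have chi: "inv_chi_star H m = ereal r" and val: "?val \<mu> = ereal r"
    by auto
  have "1 / r \<le> 2 ^ m"
    using r_bounds r_pos by (simp add: field_simps)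
  moreover have "chi_star H m = ereal (1 / r)" "omega_star H m = ereal (1 / r)"
    using r_pos by (simp_all add: chi_star_def omega_star_def chi r ereal_recip_def)
  moreover have "ereal_recip (ereal (1 / r)) = ereal r"
    using r_pos by (simp add: ereal_recip_def)
  ultimately show ?thesis
    using \<mu>(1) val by auto
qed

end
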